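(* Let $X$ be a connected, globally hyperbolic Lorentzian length space with a time function $T:X\to\mathbb{R}$ and let $d_T$ be the associated null distance. Let $J(x,y)$ be any causal diamond in $X$ and let $\{D_i\}_{i=1}^n$ be an open cover of $J(x,y)$ consisting of timelike diamonds of $X$. Then there exists $\varepsilon>0$ such that any causal (and hence any timelike) diamond with $d_T$-diameter less than $\varepsilon$ contained in $J(x,y)$ is also contained in one element $D_i$ of the covering.
   Context: **Lorentzian length spaces.** A Lorentzian pre-length space $(X,d,\ll,\leq,\tau)$ is a metric space $(X,d)$ with a reflexive transitive relation $\leq$ (causal relation), a transitive relation $\ll$ contained in $\leq$ (timelike relation), and a map $\tau:X\times X\to[0,\infty]$, lower semicontinuous w.r.t. $d$, with $\tau(x,y)=0$ if $x\not\leq y$, $\tau(x,y)>0\iff x\ll y$, and $\tau(x,z)\geq\tau(x,y)+\tau(y,z)$ whenever $x\leq y\leq z$. Topological notions refer to $d$. $J^+(x)=\{y: x\leq y\}$, $J^-(x)=\{y:y\leq x\}$, $I^{\pm}(x)$ likewise with $\ll$; causal diamonds are the sets $J(x,y)=J^+(x)\cap J^-(y)$ and timelike diamonds the sets $I(x,y)=I^+(x)\cap I^-(y)$. A non-constant locally Lipschitz curve $\gamma$ is (future-directed) causal (timelike) if $s<t$ implies $\gamma(s)\leq\gamma(t)$ ($\gamma(s)\ll\gamma(t)$); past-directed curves are the reversed ones. $L_\tau(\gamma)$ is the infimum over partitions of $\sum_i\tau(\gamma(t_i),\gamma(t_{i+1}))$. $X$ is causally path connected if $x\leq y$, $x\neq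 y$ (resp. $x\ll y$) implies there is a future-directed causal (resp. timelike) curve from $x$ to $y$; locally causally closed if every point has a neighbourhood $U$ such that $p_n,q_n\in U$, $p_n\leq q_n$, $p_n\to p\in\overline U$, $q_n\to q\in\overline U$ imply $p\leq q$; localisable if every $x$ has an open neighbourhood $\Omega_x$ such that: (1) the $d$-lengths of causal curves in $\Omega_x$ are uniformly bounded; (2) there is a continuous $\omega_x:\Omega_x\times\Omega_x\to[0,\infty)$ making $\Omega_x$ (with restricted $d,\ll,\leq$) a Lorentzian pre-length space, and $I^\pm(y)\cap\Omega_x\neq\emptyset$ for all $y\in\Omega_x$; (3) for all $p\leq q$, $p\neq q$ in $\Omega_x$ there is a future-directed causal curve from $p$ to $q$ in $\Omega_x$ of maximal $\tau$-length among causal curves from $p$ to $q$ in $\Omega_x$, with $\tau$-length $\omega_x(p,q)\leq\tau(p,q)$. A Lorentzian length space is a locally causally closed, causally path connected, localisable Lorentzian pre-length space such that $\tau(x,y)$ is the supremum of $L_\tau(\gamma)$ over future-directed causal curves $\gamma$ from $x$ to $y$ if such curves exist, and $0$ otherwise. $X$ is globally hyperbolic if all $J(x,y)$ are compact and $X$ is non-totally imprisoning (for each compact $C\subseteq X$ the $d$-lengths of causal curves in $C$ are uniformly bounded). **Null distance.** A time function is a continuous $T:X\to\mathbb{R}$ with $T(x)<T(y)$ whenever $x\leq y$, $x\neq y$. A curve $\gamma:[a,b]\to X$ is piecewise causal if there is a partition $a=s_1\leq\dots\leq s_k=b$ such that on each $[s_i,s_{i+1}]$ the curve is (future- or past-directed)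 causal or constant; its null length is $\hat L_T(\gamma)=\sum_{i=1}^{k-1}|T(\gamma(s_{i+1}))-T(\gamma(s_i))|$. The null distance is $d_T(p,q)=\inf\{\hat L_T(\gamma):\gamma\text{ piecewise causal from }p\text{ to }q\}$ (with $\inf\emptyset=\infty$). The $d_T$-diameter of a set $A$ is $\sup_{x,y\in A}d_T(x,y)$. *)

theory Defs
  imports "HOL-Analysis.Analysis"
begin

section \<open>Lorentzian pre-length spaces\<close>

definition lower_semicontinuous_on :: "'a::topological_space set \<Rightarrow> ('a \<Rightarrow> ennreal) \<Rightarrow> bool" where
  "lower_semicontinuous_on S f \<longleftrightarrow>
     (\<forall>c. openin (top_of_set S) {x \<in> S. c < f x})"

text \<open>The metric is the one of the type class. The carrier \<^term>\<open>X\<close> is needed because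
  localising neighbourhoods are themselves Lorentzian pre-length spaces for the restricted
  structure; elsewhere it is \<^term>\<open>UNIV\<close>. The timelike relation is \<open>ll\<close>, the causal one \<open>le\<close>.\<close>

definition lorentzian_pre_length_on ::
  "'a::metric_space set \<Rightarrow> ('a \<Rightarrow> 'a \<Rightarrow> bool) \<Rightarrow> ('a \<Rightarrow> 'a \<Rightarrow> bool) \<Rightarrow> ('a \<Rightarrow> 'a \<Rightarrow> ennreal) \<Rightarrow> bool" where
  "lorentzian_pre_length_on X ll le \<tau> \<longleftrightarrow>
     reflp_on X le \<and> transp_on X le \<and> transp_on X ll \<and>
     (\<forall>x\<in>X. \<forall>y\<in>X. ll x y \<longrightarrow> le x y) \<and>
     lower_semicontinuous_on (X \<times> X) (\<lambda>(x, y). \<tau> x y) \<and>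
     (\<forall>x\<in>X. \<forall>y\<in>X. \<not> le x y \<longrightarrow> \<tau> x y = 0) \<and>
     (\<forall>x\<in>X. \<forall>y\<in>X. 0 < \<tau> x y \<longleftrightarrow> ll x y) \<and>
     (\<forall>x\<in>X. \<forall>y\<in>X. \<forall>z\<in>X. le x y \<and> le y z \<longrightarrow> \<tau> x y + \<tau> y z \<le> \<tau> x z)"

text \<open>For \<open>R = le\<close> these are \<open>J\<^sup>+(x)\<close>, \<open>J\<^sup>-(x)\<close>, \<open>J(x,y)\<close>; for \<open>R = ll\<close> they are
  \<open>I\<^sup>+(x)\<close>, \<open>I\<^sup>-(x)\<close>, \<open>I(x,y)\<close>.\<close>

definition future_set :: "('a \<Rightarrow> 'a \<Rightarrow> bool) \<Rightarrow> 'a \<Rightarrow> 'a set" where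
  "future_set R x = {y. R x y}"

definition past_set :: "('a \<Rightarrow> 'a \<Rightarrow> bool) \<Rightarrow> 'a \<Rightarrow> 'a set" where
  "past_set R x = {y. R y x}"

definition diamond :: "('a \<Rightarrow> 'a \<Rightarrow> bool) \<Rightarrow> 'a \<Rightarrow> 'a \<Rightarrow> 'a set" where
  "diamond R x y = future_set R x \<inter> past_set R y"


section \<open>Curves and their lengths\<close>

definition locally_lipschitz_on :: "real set \<Rightarrow> (real \<Rightarrow> 'a::metric_space) \<Rightarrow> bool" where
  "locally_lipschitz_on I \<gamma> \<longleftrightarrow> (\<forall>t\<in>I. \<exists>e>0. \<exists>L. L-lipschitz_on (ball t e \<inter> I) \<gamma>)"

definition future_directed_on ::
  "('a::metric_space \<Rightarrow> 'a \<Rightarrow> bool) \<Rightarrow> real set \<Rightarrow> (real \<Rightarrow> 'a) \<Rightarrow> bool" where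
  "future_directed_on R I \<gamma> \<longleftrightarrow>
     is_interval I \<and> \<not> \<gamma> constant_on I \<and> locally_lipschitz_on I \<gamma> \<and>
     (\<forall>s\<in>I. \<forall>t\<in>I. s < t \<longrightarrow> R (\<gamma> s) (\<gamma> t))"

definition past_directed_on ::
  "('a::metric_space \<Rightarrow> 'a \<Rightarrow> bool) \<Rightarrow> real set \<Rightarrow> (real \<Rightarrow> 'a) \<Rightarrow> bool" where
  "past_directed_on R I \<gamma> \<longleftrightarrow> future_directed_on (\<lambda>x y. R y x) I \<gamma>"

definition future_curve_from_to ::
  "('a::metric_space \<Rightarrow> 'a \<Rightarrow> bool) \<Rightarrow> (real \<Rightarrow> 'a) \<Rightarrow> real \<Rightarrow> real \<Rightarrow> 'a \<Rightarrow> 'a \<Rightarrow> bool" where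
  "future_curve_from_to R \<gamma> a b x y \<longleftrightarrow>
     a < b \<and> future_directed_on R {a..b} \<gamma> \<and> \<gamma> a = x \<and> \<gamma> b = y"

text \<open>The parameter domain \<open>I\<close> may be any interval, hence the supremum over all finite
  increasing sequences of parameters in \<open>I\<close>.\<close>

definition d_length :: "real set \<Rightarrow> (real \<Rightarrow> 'a::metric_space) \<Rightarrow> ennreal" where
  "d_length I \<gamma> =
     Sup {(\<Sum>i<n. ennreal (dist (\<gamma> (t i)) (\<gamma> (t (Suc i))))) | t n.
            strict_mono_on {..n} t \<and> t ` {..n} \<subseteq> I}"

definition tau_length ::
  "('a \<Rightarrow> 'a \<Rightarrow> ennreal) \<Rightarrow> real \<Rightarrow> real \<Rightarrow> (real \<Rightarrow> 'a) \<Rightarrow> ennreal" where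
  "tau_length \<tau> a b \<gamma> =
     Inf {(\<Sum>i<n. \<tau> (\<gamma> (t i)) (\<gamma> (t (Suc i)))) | t (n::nat).
            strict_mono_on {..n} t \<and> t 0 = a \<and> t n = b}"

definition causal_lengths_bounded_in ::
  "('a::metric_space \<Rightarrow> 'a \<Rightarrow> bool) \<Rightarrow> 'a set \<Rightarrow> bool" where
  "causal_lengths_bounded_in le S \<longleftrightarrow>
     (\<exists>C::real. \<forall>I \<gamma>. (future_directed_on le I \<gamma> \<or> past_directed_on le I \<gamma>) \<and> \<gamma> ` I \<subseteq> S
        \<longrightarrow> d_length I \<gamma> \<le> ennreal C)"


section \<open>Lorentzian length spaces\<close>

definition causally_path_connected ::
  "('a::metric_space \<Rightarrow> 'a \<Rightarrow> bool) \<Rightarrow> ('a \<Rightarrow> 'a \<Rightarrow> bool) \<Rightarrow> bool" where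
  "causally_path_connected ll le \<longleftrightarrow>
     (\<forall>x y. le x y \<and> x \<noteq> y \<longrightarrow> (\<exists>\<gamma> a b. future_curve_from_to le \<gamma> a b x y)) \<and>
     (\<forall>x y. ll x y \<longrightarrow> (\<exists>\<gamma> a b. future_curve_from_to ll \<gamma> a b x y))"

definition locally_causally_closed :: "('a::metric_space \<Rightarrow> 'a \<Rightarrow> bool) \<Rightarrow> bool" where
  "locally_causally_closed le \<longleftrightarrow>
     (\<forall>x. \<exists>U. x \<in> interior U \<and>
        (\<forall>(u :: nat \<Rightarrow> 'a) (v :: nat \<Rightarrow> 'a) p q.
           (\<forall>n. u n \<in> U \<and> v n \<in> U \<and> le (u n) (v n)) \<and>
           u \<longlonglongrightarrow> p \<and> p \<in> closure U \<and> v \<longlonglongrightarrow> q \<and> q \<in> closure U \<longrightarrow> le p q))"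

definition localising_neighbourhood ::
  "('a::metric_space \<Rightarrow> 'a \<Rightarrow> bool) \<Rightarrow> ('a \<Rightarrow> 'a \<Rightarrow> bool) \<Rightarrow> ('a \<Rightarrow> 'a \<Rightarrow> ennreal) \<Rightarrow>
   'a set \<Rightarrow> ('a \<Rightarrow> 'a \<Rightarrow> real) \<Rightarrow> bool" where
  "localising_neighbourhood ll le \<tau> \<Omega> \<omega> \<longleftrightarrow>
     open \<Omega> \<and>
     causal_lengths_bounded_in le \<Omega> \<and>
     continuous_on (\<Omega> \<times> \<Omega>) (\<lambda>(p, q). \<omega> p q) \<and>
     (\<forall>p\<in>\<Omega>. \<forall>q\<in>\<Omega>. 0 \<le> \<omega> p q) \<and>
     lorentzian_pre_length_on \<Omega> ll le (\<lambda>p q. ennreal (\<omega> p q)) \<and>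
     (\<forall>y\<in>\<Omega>. future_set ll y \<inter> \<Omega> \<noteq> {} \<and> past_set ll y \<inter> \<Omega> \<noteq> {}) \<and>
     (\<forall>p\<in>\<Omega>. \<forall>q\<in>\<Omega>. le p q \<and> p \<noteq> q \<longrightarrow>
        (\<exists>\<gamma> a b. future_curve_from_to le \<gamma> a b p q \<and> \<gamma> ` {a..b} \<subseteq> \<Omega> \<and>
           (\<forall>\<sigma> c e. future_curve_from_to le \<sigma> c e p q \<and> \<sigma> ` {c..e} \<subseteq> \<Omega> \<longrightarrow>
              tau_length \<tau> c e \<sigma> \<le> tau_length \<tau> a b \<gamma>) \<and>
           tau_length \<tau> a b \<gamma> = ennreal (\<omega> p q) \<and> ennreal (\<omega> p q) \<le> \<tau> p q))"

definition localisable ::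
  "('a::metric_space \<Rightarrow> 'a \<Rightarrow> bool) \<Rightarrow> ('a \<Rightarrow> 'a \<Rightarrow> bool) \<Rightarrow> ('a \<Rightarrow> 'a \<Rightarrow> ennreal) \<Rightarrow> bool" where
  "localisable ll le \<tau> \<longleftrightarrow>
     (\<forall>x. \<exists>\<Omega> \<omega>. x \<in> \<Omega> \<and> localising_neighbourhood ll le \<tau> \<Omega> \<omega>)"

definition lorentzian_length_space ::
  "('a::metric_space \<Rightarrow> 'a \<Rightarrow> bool) \<Rightarrow> ('a \<Rightarrow> 'a \<Rightarrow> bool) \<Rightarrow> ('a \<Rightarrow> 'a \<Rightarrow> ennreal) \<Rightarrow> bool" where
  "lorentzian_length_space ll le \<tau> \<longleftrightarrow>
     lorentzian_pre_length_on UNIV ll le \<tau> \<and>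
     locally_causally_closed le \<and>
     causally_path_connected ll le \<and>
     localisable ll le \<tau> \<and>
     (\<forall>x y. \<tau> x y =
        (if \<exists>\<gamma> a b. future_curve_from_to le \<gamma> a b x y
         then Sup {tau_length \<tau> a b \<gamma> | \<gamma> a b. future_curve_from_to le \<gamma> a b x y}
         else 0))"

definition non_totally_imprisoning :: "('a::metric_space \<Rightarrow> 'a \<Rightarrow> bool) \<Rightarrow> bool" where
  "non_totally_imprisoning le \<longleftrightarrow> (\<forall>C. compact C \<longrightarrow> causal_lengths_bounded_in le C)"

definition globally_hyperbolic :: "('a::metric_space \<Rightarrow> 'a \<Rightarrow> bool) \<Rightarrow> bool" where
  "globally_hyperbolic le \<longleftrightarrow>
     (\<forall>x y. compact (diamond le x y)) \<and> non_totally_imprisoning le"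


section \<open>Null distance\<close>

definition is_time_function :: "('a::metric_space \<Rightarrow> 'a \<Rightarrow> bool) \<Rightarrow> ('a \<Rightarrow> real) \<Rightarrow> bool" where
  "is_time_function le T \<longleftrightarrow>
     continuous_on UNIV T \<and> (\<forall>x y. le x y \<and> x \<noteq> y \<longrightarrow> T x < T y)"

text \<open>The partition \<open>a = s 0 \<le> \<dots> \<le> s n = b\<close> is an argument, as the null length is
  expressed through it. Continuity of \<open>\<gamma>\<close> on \<open>{a..b}\<close> follows from
  that on the finitely many closed pieces.\<close>

definition piecewise_causal ::
  "('a::metric_space \<Rightarrow> 'a \<Rightarrow> bool) \<Rightarrow> (real \<Rightarrow> 'a) \<Rightarrow> real \<Rightarrow> real \<Rightarrow> (nat \<Rightarrow> real) \<Rightarrow> nat \<Rightarrow> bool" where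
  "piecewise_causal le \<gamma> a b s n \<longleftrightarrow>
     mono_on {..n} s \<and> s 0 = a \<and> s n = b \<and>
     (\<forall>i<n. future_directed_on le {s i..s (Suc i)} \<gamma> \<or>
            past_directed_on le {s i..s (Suc i)} \<gamma> \<or>
            \<gamma> constant_on {s i..s (Suc i)})"

definition null_length ::
  "('a \<Rightarrow> real) \<Rightarrow> (real \<Rightarrow> 'a) \<Rightarrow> (nat \<Rightarrow> real) \<Rightarrow> nat \<Rightarrow> real" where
  "null_length T \<gamma> s n = (\<Sum>i<n. \<bar>T (\<gamma> (s (Suc i))) - T (\<gamma> (s i))\<bar>)"

definition null_distance ::
  "('a::metric_space \<Rightarrow> 'a \<Rightarrow> bool) \<Rightarrow> ('a \<Rightarrow> real) \<Rightarrow> 'a \<Rightarrow> 'a \<Rightarrow> ennreal" where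
  "null_distance le T p q =
     Inf {ennreal (null_length T \<gamma> s n) | \<gamma> a b s n.
            piecewise_causal le \<gamma> a b s n \<and> \<gamma> a = p \<and> \<gamma> b = q}"

definition null_diameter ::
  "('a::metric_space \<Rightarrow> 'a \<Rightarrow> bool) \<Rightarrow> ('a \<Rightarrow> real) \<Rightarrow> 'a set \<Rightarrow> ennreal" where
  "null_diameter le T A = (SUP x\<in>A. SUP y\<in>A. null_distance le T x y)"

end

theory Submission
  imports Defs
begin

text \<open>Write \<open>K = J(x,y)\<close>. For \<open>p \<le> q\<close> the null distance is at least \<open>T q - T p\<close>, so a diamond
  of small diameter has endpoints with nearly equal time. On the compact set \<open>K\<close> this forces
  \<open>p\<close> and \<open>q\<close> to be close for \<open>d\<close>: otherwise there are \<open>p\<^sub>k \<le> q\<^sub>k\<close> with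
  \<open>d(p\<^sub>k,q\<^sub>k) \<ge> \<delta>\<close> and \<open>T q\<^sub>k - T p\<^sub>k \<rightarrow> 0\<close>, and causal curves from \<open>p\<^sub>k\<close> to \<open>q\<^sub>k\<close> contain points \<open>r\<^sub>k\<close>
  at a fixed small distance from \<open>p\<^sub>k\<close>; limits \<open>p\<close>, \<open>r\<close> then satisfy \<open>p \<le> r\<close> by local causal
  closedness, \<open>p \<noteq> r\<close> and \<open>T p = T r\<close>, a contradiction. Hence diamonds of small null diameter
  are small for \<open>d\<close>, and the Lebesgue number of the cover finishes the proof. A timelike diamond
  reduces to the causal one because its endpoints lie in its closure.\<close>

lemma locally_lipschitz_on_imp_continuous_on:
  assumes "locally_lipschitz_on I \<gamma>"
  shows "continuous_on I \<gamma>"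
  unfolding continuous_on_eq_continuous_within
proof
  fix t assume t: "t \<in> I"
  then obtain e L where e: "e > 0" and L: "L-lipschitz_on (ball t e \<inter> I) \<gamma>"
    using assms unfolding locally_lipschitz_on_def by blast
  have "continuous (at t within ball t e \<inter> I) \<gamma>"
    using lipschitz_on_continuous_on[OF L] e t by (simp add: continuous_on_eq_continuous_within)
  moreover have "at t within (I \<inter> ball t e) = at t within I"
    by (rule at_within_nhd[of _ "ball t e"]) (use e in auto)
  ultimately show "continuous (at t within I) \<gamma>"
    by (simp add: Int_commute continuous_within)
qed

lemma future_curve_continuous_on:
  assumes "future_curve_from_to R \<gamma> a b x y"
  shows "continuous_on {a..b} \<gamma>"
  using assms locally_lipschitz_on_imp_continuous_on
  unfolding future_curve_from_to_def future_directed_on_def by blast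

lemma future_curve_relD:
  assumes "future_curve_from_to R \<gamma> a b x y" "a \<le> s" "s < t" "t \<le> b"
  shows "R (\<gamma> s) (\<gamma> t)"
  using assms unfolding future_curve_from_to_def future_directed_on_def by auto

lemma time_function_mono:
  assumes "is_time_function le T" "le x y"
  shows "T x \<le> T y"
  using assms unfolding is_time_function_def by (cases "x = y") (auto intro: less_imp_le)

text \<open>The signed time differences along a piecewise causal curve telescope, and each is at
  most its absolute value. If \<open>T q < T p\<close>, then \<open>ennreal\<close> truncates the
  left side to 0, so no causal relation between the points has to be assumed.\<close>

lemma time_diff_le_null_distance: "ennreal (T q - T p) \<le> null_distance le T p q"
  unfolding null_distance_def
proof (rule Inf_greatest, clarify)
  fix \<gamma> a b and s :: "nat \<Rightarrow> real" and n
  assume "piecewise_causal le \<gamma> a b s n"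
  then have "T (\<gamma> b) - T (\<gamma> a) = (\<Sum>i<n. T (\<gamma> (s (Suc i))) - T (\<gamma> (s i)))"
    by (simp add: piecewise_causal_def sum_lessThan_telescope[of "\<lambda>i. T (\<gamma> (s i))"])
  also have "\<dots> \<le> null_length T \<gamma> s n"
    unfolding null_length_def by (intro sum_mono abs_ge_self)
  finally show "ennreal (T (\<gamma> b) - T (\<gamma> a)) \<le> ennreal (null_length T \<gamma> s n)"
    by (rule ennreal_leI)
qed

lemma time_diff_le_null_diameter:
  assumes "p \<in> A" "q \<in> A"
  shows "ennreal (T q - T p) \<le> null_diameter le T A"
  unfolding null_diameter_def
  by (rule SUP_upper2[OF assms(1)], rule SUP_upper2[OF assms(2)], rule time_diff_le_null_distance)

text \<open>Along a causal curve from \<open>p\<close> to \<open>q\<close> the distance to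
  \<open>p\<close> is continuous and runs from 0 to \<open>dist p q\<close>, so it takes the value
  \<open>\<eta>\<close>. Reflexivity covers a parameter that is an endpoint, because curves relate
  only distinct parameters.\<close>

lemma exists_causal_intermediate_point:
  assumes "causally_path_connected ll le" "\<And>z. le z z"
    and "le p q" "0 < \<eta>" "\<eta> \<le> dist p q"
  obtains r where "le p r" "le r q" "dist p r = \<eta>"
proof -
  have "p \<noteq> q" using assms(4,5) by auto
  then obtain \<gamma> a b where \<gamma>: "future_curve_from_to le \<gamma> a b p q"
    using assms(1,3) unfolding causally_path_connected_def by blast
  then have ab: "a < b" "\<gamma> a = p" "\<gamma> b = q" by (auto simp: future_curve_from_to_def)
  have "continuous_on {a..b} (\<lambda>t. dist p (\<gamma> t))"
    by (intro continuous_intros future_curve_continuous_on[OF \<gamma>])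
  then obtain t where t: "a \<le> t" "t \<le> b" "dist p (\<gamma> t) = \<eta>"
    using IVT'[of "\<lambda>t. dist p (\<gamma> t)" a \<eta> b] ab assms(4,5) by auto
  have "le p (\<gamma> t)"
    using future_curve_relD[OF \<gamma>, of a t] t ab assms(2) by (cases "a = t") auto
  moreover have "le (\<gamma> t) q"
    using future_curve_relD[OF \<gamma>, of t b] t ab assms(2) by (cases "t = b") auto
  ultimately show thesis using t that by blast
qed

text \<open>This replaces smallness in time by smallness in \<open>d\<close>, uniformly over
  \<open>K\<close>. The whole diamond is required to lie in \<open>K\<close>, so that compactness
  applies to the intermediate points as well as to \<open>p\<close>.\<close>

lemma causally_related_dist_less:
  assumes closed: "locally_causally_closed le"
    and conn: "causally_path_connected ll le" and refl: "\<And>z. le z z"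
    and time: "is_time_function le T"
    and K: "compact K" and \<delta>: "0 < \<delta>"
  shows "\<exists>\<epsilon>>0. \<forall>p q. le p q \<and> diamond le p q \<subseteq> K \<and> T q - T p < \<epsilon> \<longrightarrow> dist p q < \<delta>"
proof (rule ccontr)
  assume contra: "\<not> ?thesis"
  have "\<exists>p q. le p q \<and> diamond le p q \<subseteq> K \<and> T q - T p < inverse (real (Suc n)) \<and> \<delta> \<le> dist p q"
    for n
    using contra by (force simp: not_less)
  then obtain P Q where PQ: "\<And>n. le (P n) (Q n)" "\<And>n. diamond le (P n) (Q n) \<subseteq> K"
      "\<And>n. T (Q n) - T (P n) < inverse (real (Suc n))" "\<And>n. \<delta> \<le> dist (P n) (Q n)"
    by metis
  have "P n \<in> K" for n
    using PQ(1,2)[of n] refl by (auto simp: diamond_def future_set_def past_set_def)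
  then obtain p f where p: "p \<in> K" and f: "strict_mono f" "(P \<circ> f) \<longlonglongrightarrow> p"
    using K unfolding compact_def by metis
  obtain U where U: "p \<in> interior U" and
    U_closed: "\<And>(u :: nat \<Rightarrow> 'a) v p q. \<lbrakk>\<And>n. u n \<in> U \<and> v n \<in> U \<and> le (u n) (v n); u \<longlonglongrightarrow> p;
        p \<in> closure U; v \<longlonglongrightarrow> q; q \<in> closure U\<rbrakk> \<Longrightarrow> le p q"
    using closed unfolding locally_causally_closed_def by meson
  obtain e where e: "e > 0" "ball p e \<subseteq> interior U"
    using U open_contains_ball open_interior by blast
  \<comment> \<open>The bound \<open>\<eta> \<le> \<delta>\<close> guarantees intermediate points at
    distance \<open>\<eta>\<close>; the factor 1/2 makes \<open>\<eta> < e\<close>, so their limit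
    stays in the open ball inside \<open>U\<close>.\<close>
  define \<eta> where "\<eta> = min \<delta> (e / 2)"
  have \<eta>: "0 < \<eta>" "\<eta> \<le> \<delta>" "\<eta> < e" using \<delta> e by (auto simp: \<eta>_def)
  have "\<exists>r. le (P n) r \<and> le r (Q n) \<and> dist (P n) r = \<eta>" for n
    using exists_causal_intermediate_point[OF conn refl PQ(1)[of n] \<eta>(1)] PQ(4)[of n] \<eta>(2)
    by (metis order_trans)
  then obtain R where R: "\<And>n. le (P n) (R n)" "\<And>n. le (R n) (Q n)" "\<And>n. dist (P n) (R n) = \<eta>"
    by metis
  have "(R \<circ> f) n \<in> K" for n
    using PQ(2)[of "f n"] R(1,2)[of "f n"] by (auto simp: diamond_def future_set_def past_set_def)
  then obtain r g where g: "strict_mono g" "(R \<circ> f \<circ> g) \<longlonglongrightarrow> r"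
    using K unfolding compact_def by metis
  define h where "h = f \<circ> g"
  have h: "strict_mono h" unfolding h_def by (intro strict_mono_o f g)
  have Ph: "(\<lambda>n. P (h n)) \<longlonglongrightarrow> p"
    using LIMSEQ_subseq_LIMSEQ[OF f(2) g(1)] by (simp add: h_def o_def)
  have Rh: "(\<lambda>n. R (h n)) \<longlonglongrightarrow> r" using g(2) by (simp add: h_def o_def)
  have dist_pr: "dist p r = \<eta>"
    using tendsto_dist[OF Ph Rh] R(3) by (simp add: LIMSEQ_const_iff)
  have r: "r \<in> interior U" using e(2) dist_pr \<eta>(3) by auto
  have "\<forall>\<^sub>F n in sequentially. P (h n) \<in> U \<and> R (h n) \<in> U"
    using topological_tendstoD[OF Ph open_interior U] topological_tendstoD[OF Rh open_interior r]
    by eventually_elim (use interior_subset in blast)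
  then obtain N where N: "\<And>n. n \<ge> N \<Longrightarrow> P (h n) \<in> U \<and> R (h n) \<in> U"
    unfolding eventually_sequentially by blast
  \<comment> \<open>Local causal closedness asks that all terms lie in \<open>U\<close>, hence the
    shift by \<open>N\<close>.\<close>
  have "le p r"
  proof (rule U_closed[where u = "\<lambda>n. P (h (n + N))" and v = "\<lambda>n. R (h (n + N))"])
    show "P (h (n + N)) \<in> U \<and> R (h (n + N)) \<in> U \<and> le (P (h (n + N))) (R (h (n + N)))" for n
      using N[of "n + N"] R(1) by simp
    show "(\<lambda>n. P (h (n + N))) \<longlonglongrightarrow> p" "(\<lambda>n. R (h (n + N))) \<longlonglongrightarrow> r"
      by (intro LIMSEQ_ignore_initial_segment Ph Rh)+
    show "p \<in> closure U" "r \<in> closure U"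
      using U r interior_subset closure_subset by blast+
  qed
  moreover have "p \<noteq> r" using dist_pr \<eta>(1) by auto
  ultimately have "T p < T r" using time unfolding is_time_function_def by blast
  moreover have "T r - T p \<le> 0"
  proof (rule LIMSEQ_le)
    have "isCont T z" for z
      using time by (simp add: is_time_function_def continuous_on_eq_continuous_at)
    then show "(\<lambda>n. T (R (h n)) - T (P (h n))) \<longlonglongrightarrow> T r - T p"
      by (intro tendsto_diff isCont_tendsto_compose[where g = T] Ph Rh)
    show "(\<lambda>n. inverse (real (Suc (h n)))) \<longlonglongrightarrow> 0"
      using LIMSEQ_subseq_LIMSEQ[OF LIMSEQ_inverse_real_of_nat h] by (simp add: o_def)
    \<comment> \<open>Since \<open>R\<close> precedes \<open>Q\<close> causally, the time gap from
      \<open>P\<close> to \<open>R\<close> is at most the one from \<open>P\<close> to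
      \<open>Q\<close>.\<close>
    have "T (R (h n)) - T (P (h n)) \<le> inverse (real (Suc (h n)))" for n
      using time_function_mono[OF time R(2)[of "h n"]] PQ(3)[of "h n"] by linarith
    then show "\<exists>N. \<forall>n\<ge>N. T (R (h n)) - T (P (h n)) \<le> inverse (real (Suc (h n)))"
      by blast
  qed
  ultimately show False by simp
qed

text \<open>All points of a timelike curve from \<open>p\<close> to \<open>q\<close> at interior
  parameters lie in the timelike diamond, and by continuity they approach both ends.\<close>

lemma timelike_diamond_approximation:
  assumes conn: "causally_path_connected ll le" and "ll p q"
  obtains u v where "u \<longlonglongrightarrow> p" "v \<longlonglongrightarrow> q" "\<And>n. u n \<in> diamond ll p q" "\<And>n. v n \<in> diamond ll p q"
proof -
  obtain \<gamma> a b where \<gamma>: "future_curve_from_to ll \<gamma> a b p q"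
    using assms unfolding causally_path_connected_def by blast
  then have ab: "a < b" "\<gamma> a = p" "\<gamma> b = q" by (auto simp: future_curve_from_to_def)
  have mem: "\<gamma> t \<in> diamond ll p q" if "a < t" "t < b" for t
    using future_curve_relD[OF \<gamma>, of a t] future_curve_relD[OF \<gamma>, of t b] that ab
    by (simp add: diamond_def future_set_def past_set_def)
  have lim: "(\<lambda>n. \<gamma> (t n)) \<longlonglongrightarrow> \<gamma> c"
    if "t \<longlonglongrightarrow> c" "c \<in> {a..b}" "\<And>n. a < t n \<and> t n < b" for t :: "nat \<Rightarrow> real" and c
    using continuous_on_tendsto_compose[OF future_curve_continuous_on[OF \<gamma>] that(1,2)] that(3)
    by (auto simp: less_imp_le)
  \<comment> \<open>The denominator is n + 2 rather than n + 1, so that already for n = 0 both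
    \<open>a + w n\<close> and \<open>b - w n\<close> are strictly between \<open>a\<close> and
    \<open>b\<close>.\<close>
  define w where "w n = (b - a) * inverse (real (Suc (Suc n)))" for n
  have w: "0 < w n" "w n < b - a" for n
    using ab(1) mult_strict_left_mono[of "inverse (real (Suc (Suc n)))" 1 "b - a"]
    by (simp_all add: w_def inverse_less_1_iff)
  have "w \<longlonglongrightarrow> 0"
    unfolding w_def using tendsto_mult_right_zero[OF LIMSEQ_Suc[OF LIMSEQ_inverse_real_of_nat]] .
  then have "(\<lambda>n. a + w n) \<longlonglongrightarrow> a" "(\<lambda>n. b - w n) \<longlonglongrightarrow> b"
    using tendsto_add[OF tendsto_const, of w 0 sequentially a]
      tendsto_diff[OF tendsto_const, of w 0 sequentially b] by simp_all
  then have "(\<lambda>n. \<gamma> (a + w n)) \<longlonglongrightarrow> p" "(\<lambda>n. \<gamma> (b - w n)) \<longlonglongrightarrow> q"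
    using lim[of "\<lambda>n. a + w n" a] lim[of "\<lambda>n. b - w n" b] w ab
    by (simp_all add: less_diff_eq diff_less_eq add.commute)
  moreover have "\<gamma> (a + w n) \<in> diamond ll p q" "\<gamma> (b - w n) \<in> diamond ll p q" for n
    using w[of n] by (auto intro!: mem)
  ultimately show thesis by (rule that)
qed

text \<open>The endpoints need not belong to the timelike diamond, so the bound is applied to points
  inside it and passed to the limit by continuity of \<open>T\<close>.\<close>

lemma timelike_diamond_time_diff_le:
  assumes "causally_path_connected ll le" "continuous_on UNIV T" "ll p q"
  shows "ennreal (T q - T p) \<le> null_diameter le T (diamond ll p q)"
proof -
  obtain u v where uv: "u \<longlonglongrightarrow> p" "v \<longlonglongrightarrow> q"
      "\<And>n. u n \<in> diamond ll p q" "\<And>n. v n \<in> diamond ll p q"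
    using timelike_diamond_approximation[OF assms(1,3)] by blast
  have "isCont T z" for z
    using assms(2) by (simp add: continuous_on_eq_continuous_at)
  then have "(\<lambda>n. ennreal (T (v n) - T (u n))) \<longlonglongrightarrow> ennreal (T q - T p)"
    by (intro tendsto_ennrealI tendsto_diff isCont_tendsto_compose[where g = T] uv)
  then show ?thesis
    by (rule LIMSEQ_le_const2) (use time_diff_le_null_diameter uv in blast)
qed

theorem lemma3p1:
  fixes ll le :: "'a::metric_space \<Rightarrow> 'a \<Rightarrow> bool"
    and \<tau> :: "'a \<Rightarrow> 'a \<Rightarrow> ennreal"
    and T :: "'a \<Rightarrow> real"
    and x y :: 'a
    and n :: nat
    and D :: "nat \<Rightarrow> 'a set"
  assumes "lorentzian_length_space ll le \<tau>"
    and "connected (UNIV :: 'a set)"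
    and "globally_hyperbolic le"
    and "is_time_function le T"
    and "n \<ge> 1"
    and "\<And>i. i \<in> {1..n} \<Longrightarrow> \<exists>p q. D i = diamond ll p q"
    and "\<And>i. i \<in> {1..n} \<Longrightarrow> open (D i)"
    and "diamond le x y \<subseteq> (\<Union>i\<in>{1..n}. D i)"
  shows "\<exists>\<epsilon>::real. \<epsilon> > 0 \<and>
    (\<forall>p q. null_diameter le T (diamond le p q) < ennreal \<epsilon> \<and> diamond le p q \<subseteq> diamond le x y
       \<longrightarrow> (\<exists>i\<in>{1..n}. diamond le p q \<subseteq> D i)) \<and>
    (\<forall>p q. null_diameter le T (diamond ll p q) < ennreal \<epsilon> \<and> diamond ll p q \<subseteq> diamond le x y
       \<longrightarrow> (\<exists>i\<in>{1..n}. diamond ll p q \<subseteq> D i))"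
proof -
  have pre: "lorentzian_pre_length_on UNIV ll le \<tau>" and closed: "locally_causally_closed le"
    and conn: "causally_path_connected ll le"
    using assms(1) by (auto simp: lorentzian_length_space_def)
  have refl: "le z z" and trans_le: "le u v \<Longrightarrow> le v w \<Longrightarrow> le u w"
    and trans_ll: "ll u v \<Longrightarrow> ll v w \<Longrightarrow> ll u w" and ll_le: "ll u v \<Longrightarrow> le u v" for u v w z
    using pre unfolding lorentzian_pre_length_on_def
    by (auto dest: reflp_onD transp_onD)
  have cont: "continuous_on UNIV T" using assms(4) by (simp add: is_time_function_def)
  define K where "K = diamond le x y"
  have K: "compact K" using assms(3) by (simp add: globally_hyperbolic_def K_def)
  have diamond_subset: "diamond le p q \<subseteq> K" if "p \<in> K" "q \<in> K" for p q
    using that by (auto simp: K_def diamond_def future_set_def past_set_def intro: trans_le)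
  \<comment> \<open>\<open>\<delta>\<close> is a Lebesgue number of the cover on
    \<open>K\<close>.\<close>
  obtain \<delta> where \<delta>: "\<delta> > 0" "\<And>z. z \<in> K \<Longrightarrow> \<exists>G \<in> D ` {1..n}. ball z \<delta> \<subseteq> G"
    using Heine_Borel_lemma[OF K, of "D ` {1..n}"] assms(7,8) unfolding K_def by blast
  obtain \<epsilon> where \<epsilon>: "\<epsilon> > 0"
      "\<And>p q. le p q \<Longrightarrow> diamond le p q \<subseteq> K \<Longrightarrow> T q - T p < \<epsilon> \<Longrightarrow> dist p q < \<delta>"
    using causally_related_dist_less[OF closed conn refl assms(4) K \<delta>(1)] by blast
  \<comment> \<open>Both kinds of diamonds reduce to this: the diameter enters only through
    \<open>T q - T p\<close>. Each \<open>z\<close> between \<open>p\<close> and \<open>q\<close>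
    has \<open>T z - T p \<le> T q - T p < \<epsilon>\<close>, and the diamond of \<open>p\<close>
    and \<open>z\<close> stays in \<open>K\<close>, so \<open>z\<close> is within
    \<open>\<delta>\<close> of the fixed centre \<open>p\<close>.\<close>
  have main: "\<exists>i\<in>{1..n}. diamond le p q \<subseteq> D i"
    if "p \<in> K" "q \<in> K" "T q - T p < \<epsilon>" for p q
  proof -
    have "diamond le p q \<subseteq> ball p \<delta>"
    proof
      fix z assume z: "z \<in> diamond le p q"
      then have "le p z" "le z q" "z \<in> K"
        using diamond_subset[OF that(1,2)] by (auto simp: diamond_def future_set_def past_set_def)
      then show "z \<in> ball p \<delta>"
        using \<epsilon>(2)[of p z] diamond_subset[of p z] time_function_mono[OF assms(4), of z q] that
        by auto
    qed
    then show ?thesis using \<delta>(2)[OF that(1)] by blast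
  qed
  have "\<exists>i\<in>{1..n}. diamond le p q \<subseteq> D i"
    if diam: "null_diameter le T (diamond le p q) < ennreal \<epsilon>" and sub: "diamond le p q \<subseteq> K"
    for p q
  proof (cases "le p q")
    case True
    then have mem: "p \<in> diamond le p q" "q \<in> diamond le p q"
      using refl by (auto simp: diamond_def future_set_def past_set_def)
    \<comment> \<open>Monotonicity of \<open>T\<close> supplies the nonnegativity under which a
      strict inequality in \<open>ennreal\<close> descends to the reals.\<close>
    then have "T q - T p < \<epsilon>"
      using le_less_trans[OF time_diff_le_null_diameter[OF mem] diam] time_function_mono[OF assms(4) True]
      by (simp add: ennreal_less_iff)
    then show ?thesis using main mem sub by blast
  next
    case False
    then have "diamond le p q = {}"
      using trans_le by (auto simp: diamond_def future_set_def past_set_def)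
    \<comment> \<open>The empty diamond lies in every \<open>D i\<close>; \<open>n \<ge> 1\<close>
      provides an index.\<close>
    then show ?thesis using assms(5) by auto
  qed
  moreover have "\<exists>i\<in>{1..n}. diamond ll p q \<subseteq> D i"
    if diam: "null_diameter le T (diamond ll p q) < ennreal \<epsilon>" and sub: "diamond ll p q \<subseteq> K"
    for p q
  proof (cases "ll p q")
    case True
    obtain u v where uv: "u \<longlonglongrightarrow> p" "v \<longlonglongrightarrow> q"
        "\<And>n. u n \<in> diamond ll p q" "\<And>n. v n \<in> diamond ll p q"
      using timelike_diamond_approximation[OF conn True] by blast
    \<comment> \<open>\<open>K\<close> is closed, so it contains the limits \<open>p\<close> and
      \<open>q\<close> of points of the timelike diamond.\<close>
    have "p \<in> K" "q \<in> K"
      using closed_sequentially[OF compact_imp_closed[OF K]] uv sub by blast+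
    moreover have "T q - T p < \<epsilon>"
      using le_less_trans[OF timelike_diamond_time_diff_le[OF conn cont True] diam]
        time_function_mono[OF assms(4) ll_le[OF True]]
      by (simp add: ennreal_less_iff)
    ultimately obtain i where "i \<in> {1..n}" "diamond le p q \<subseteq> D i" using main by blast
    moreover have "diamond ll p q \<subseteq> diamond le p q"
      using ll_le by (auto simp: diamond_def future_set_def past_set_def)
    ultimately show ?thesis by blast
  next
    case False
    then have "diamond ll p q = {}"
      using trans_ll by (auto simp: diamond_def future_set_def past_set_def)
    then show ?thesis using assms(5) by auto
  qed
  ultimately show ?thesis using \<epsilon>(1) unfolding K_def by blast
qed

end
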